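(* Let $m \geq 3$ be an odd integer, and let $\mathcal{D}$ be the standard alternating closed-braid diagram of the Turk's Head knot $THK(m,2)$. If the determinant of $\mathcal{D}$ is a prime number $p$, then every non-trivial Fox $p$-coloring of $\mathcal{D}$ assigns different colors to different arcs of $\mathcal{D}$. (That is, the Harary-Kauffman conjecture holds for the diagram $\mathcal{D}$.)
   Context: For integers $m,n \geq 2$, the Turk's Head link $THK(m,n)$ is the link obtained by taking the standard braid representation of the $(m,n)$ torus link on $m$ strands and making it alternating; its standard diagram is the closed-braid diagram of the $m$-strand braid $\left(\sigma_1 \sigma_2^{-1} \sigma_3 \sigma_4^{-1} \cdots \sigma_{m-1}^{\pm 1}\right)^n$, where $\sigma_i$ are the standard braid generators and the exponent of $\sigma_i$ in each block is $+1$ for $i$ odd and $-1$ for $i$ even. It is a knot exactly when $\gcd(m,n)=1$. The determinant of a diagram is the determinant of the knot it represents. A Fox $p$-coloring of a knot diagram assigns to each arc (a maximal piece of the diagram running from one undercrossing to the next) a color in $\{0,1,\ldots,p-1\}$ such that at each crossing the over strand color $x$ and the two under strand colors $y,z$ satisfy $2x - y - z \equiv 0 \pmod p$. The coloring is non-trivial if at least two different colors are used. The Harary-Kauffman conjecture states: if $\mathcal{D}$ is an alternating knot diagram with no nugatory crossings whose determinant is a prime $p$, then every non-trivial Fox $p$-coloring of $\mathcal{D}$ assigns different colors to different arcs of $\mathcal{D}$. *)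

theory Defs
  imports "Jordan_Normal_Form.Determinant" "HOL-Number_Theory.Cong"
    "HOL-Computational_Algebra.Primes"
begin

text \<open>
  A letter \<open>(i, True)\<close> is the generator \<open>\<sigma>\<^sub>i\<close> and \<open>(i, False)\<close> is its inverse, with
  \<open>1 \<le> i < m\<close> for braids on \<open>m\<close> strands.  Both exchange the strands in positions \<open>i\<close> and
  \<open>i + 1\<close>; in \<open>\<sigma>\<^sub>i\<close> the strand moving from \<open>i\<close> to \<open>i + 1\<close> is the over strand, in its inverse
  the strand moving from \<open>i + 1\<close> to \<open>i\<close> is.
\<close>

type_synonym braid_word = "(nat \<times> bool) list"

fun over_start :: "nat \<times> bool \<Rightarrow> nat" where
  "over_start (i, s) = (if s then i else i + 1)"

fun under_start :: "nat \<times> bool \<Rightarrow> nat" where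
  "under_start (i, s) = (if s then i + 1 else i)"

abbreviation over_end :: "nat \<times> bool \<Rightarrow> nat" where
  "over_end l \<equiv> under_start l"

abbreviation under_end :: "nat \<times> bool \<Rightarrow> nat" where
  "under_end l \<equiv> over_start l"

text \<open>
  The closed braid of \<open>w\<close> is cut into segments: \<open>(j, t)\<close> is the piece of strand in position
  \<open>j\<close> between crossing \<open>t - 1\<close> and crossing \<open>t\<close>.  Crossings are numbered from 0, and the
  numbering is cyclic because the braid is closed.
\<close>

definition segments :: "nat \<Rightarrow> braid_word \<Rightarrow> (nat \<times> nat) set" where
  "segments m w = {1..m} \<times> {..<length w}"

definition next_level :: "braid_word \<Rightarrow> nat \<Rightarrow> nat" where
  "next_level w t = Suc t mod length w"

text \<open>
  Two segments that meet at a level are joined unless they form the under strand there, so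
  the classes of the generated equivalence relation are the arcs.
\<close>

definition joined :: "nat \<Rightarrow> braid_word \<Rightarrow> ((nat \<times> nat) \<times> (nat \<times> nat)) set" where
  "joined m w =
     {((j, t), (j, next_level w t)) | j t.
        j \<in> {1..m} \<and> t < length w \<and> j \<noteq> over_start (w ! t) \<and> j \<noteq> under_start (w ! t)} \<union>
     {((over_start (w ! t), t), (over_end (w ! t), next_level w t)) | t. t < length w}"

definition arc_of :: "nat \<Rightarrow> braid_word \<Rightarrow> nat \<times> nat \<Rightarrow> (nat \<times> nat) set" where
  "arc_of m w s = (joined m w \<union> (joined m w)\<inverse>)\<^sup>* `` {s}"

definition arcs :: "nat \<Rightarrow> braid_word \<Rightarrow> (nat \<times> nat) set set" where
  "arcs m w = arc_of m w ` segments m w"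

definition over_arc :: "nat \<Rightarrow> braid_word \<Rightarrow> nat \<Rightarrow> (nat \<times> nat) set" where
  "over_arc m w t = arc_of m w (over_start (w ! t), t)"

definition under_arc_in :: "nat \<Rightarrow> braid_word \<Rightarrow> nat \<Rightarrow> (nat \<times> nat) set" where
  "under_arc_in m w t = arc_of m w (under_start (w ! t), t)"

definition under_arc_out :: "nat \<Rightarrow> braid_word \<Rightarrow> nat \<Rightarrow> (nat \<times> nat) set" where
  "under_arc_out m w t = arc_of m w (under_end (w ! t), next_level w t)"

definition fox_coloring ::
  "nat \<Rightarrow> nat \<Rightarrow> braid_word \<Rightarrow> ((nat \<times> nat) set \<Rightarrow> int) \<Rightarrow> bool" where
  "fox_coloring p m w c \<longleftrightarrow>
     (\<forall>a \<in> arcs m w. c a \<in> {0..<int p}) \<and>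
     (\<forall>t < length w.
        [2 * c (over_arc m w t) - c (under_arc_in m w t) - c (under_arc_out m w t) = 0]
          (mod int p))"

definition nontrivial_coloring ::
  "nat \<Rightarrow> braid_word \<Rightarrow> ((nat \<times> nat) set \<Rightarrow> int) \<Rightarrow> bool" where
  "nontrivial_coloring m w c \<longleftrightarrow> (\<exists>a \<in> arcs m w. \<exists>b \<in> arcs m w. c a \<noteq> c b)"

text \<open>
  Row \<open>t\<close> of the coloring matrix is the coloring relation at crossing \<open>t\<close>; column \<open>u\<close> belongs
  to the arc that starts at the undercrossing \<open>u\<close>.  If every component passes under at least
  once, this lists every arc exactly once.  The determinant of the knot is the absolute value
  of a first minor of this matrix; it does not depend on the row and column deleted.
\<close>

definition coloring_matrix :: "nat \<Rightarrow> braid_word \<Rightarrow> int mat" where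
  "coloring_matrix m w = mat (length w) (length w) (\<lambda>(t, u).
     2 * of_bool (over_arc m w t = under_arc_out m w u)
     - of_bool (under_arc_in m w t = under_arc_out m w u)
     - of_bool (under_arc_out m w t = under_arc_out m w u))"

definition diagram_determinant :: "nat \<Rightarrow> braid_word \<Rightarrow> nat" where
  "diagram_determinant m w = nat \<bar>det (mat_delete (coloring_matrix m w) 0 0)\<bar>"

definition turks_head_word :: "nat \<Rightarrow> nat \<Rightarrow> braid_word" where
  "turks_head_word m n = concat (replicate n (map (\<lambda>i. (i, odd i)) [1..<m]))"

end

theory Submission
  imports Defs
begin

text \<open>
  The arcs of the diagram form a ladder with two rows and \<open>m - 1\<close> levels: at every crossing,
  the over arc \<open>(e, n)\<close> (row \<open>e\<close>, level \<open>n\<close>) separates the under arcs \<open>(e, n + 1)\<close> and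
  \<open>(e + 1, n - 1)\<close>, rows counted modulo 2 (lemma \<open>crossing_sum\<close>).  At the lower end level 0
  equals level 1, at the upper end the arc \<open>(e, m)\<close> is \<open>(e + 1, m - 1)\<close>.

  Let \<open>H\<close> be the sequence 1, 1, 3, 7, 17, ... with \<open>H (n + 2) = 2 H (n + 1) + H n\<close>.  The colors
  \<open>\<plusminus> H n\<close>, with opposite signs in the two rows, satisfy the coloring relation over the integers
  except at the upper end, where the defect is \<open>\<plusminus> Q\<close> for \<open>Q = H m + H (m - 1)\<close>.  So they form
  a coloring modulo \<open>Q\<close>.  As the determinant multiplies every difference of colors into a multiple of \<open>Q\<close>
  (an application of the adjugate matrix, lemma \<open>dvd_determinant_mult_color_diff\<close>), \<open>Q\<close> divides
  twice the determinant.  If the determinant is a prime \<open>p\<close>, this forces \<open>Q = 2 p\<close>, and the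
  determinant never has to be computed.

  Climbing the ladder, any coloring modulo \<open>p\<close> is determined by its two colors on level 0,
  so up to the factor 2 it is an affine function of the integer coloring
  (lemma \<open>colors_affine_in_pell_color\<close>).  The integers \<open>\<plusminus> H n\<close> with \<open>1 \<le> n < m\<close> are distinct,
  odd and smaller than \<open>p\<close> in absolute value, since \<open>2 H (m - 1) < Q = 2 p\<close>.  Two of them
  have an even difference smaller than \<open>2 p\<close> in absolute value, so they are distinct modulo \<open>p\<close>,
  and so are the colors of a non-trivial coloring.
\<close>

section \<open>Arcs of a closed braid diagram\<close>

lemma arc_of_eq_if_joined:
  assumes "(s, s') \<in> joined m w"
  shows "arc_of m w s = arc_of m w s'"
  using assms unfolding arc_of_def
  by (auto intro: converse_rtrancl_into_rtrancl)

text \<open>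
  If the relation \<open>R\<close> never merges two elements, then a connecting path out of an element
  without predecessor can only run forward: each backward step undoes the previous step.
\<close>
lemma component_source_unique:
  assumes inj: "\<And>x y z. (x, z) \<in> R \<Longrightarrow> (y, z) \<in> R \<Longrightarrow> x = y"
    and conn: "(s, s') \<in> (R \<union> R\<inverse>)\<^sup>*" and s: "s \<notin> Range R" and s': "s' \<notin> Range R"
  shows "s = s'"
proof -
  have "(s, s') \<in> R\<^sup>*"
    using conn
  proof (induction rule: rtrancl_induct)
    case base
    show ?case by simp
  next
    case (step y z)
    from step.hyps(2) consider "(y, z) \<in> R" | "(z, y) \<in> R" by blast
    then show ?case
    proof cases
      case 1
      with step.IH show ?thesis by (rule rtrancl_into_rtrancl)
    next
      case 2
      from step.IH show ?thesis
      proof (cases rule: rtranclE)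
        case base
        with 2 s show ?thesis by blast
      next
        case (step y')
        with 2 inj[of y' y z] show ?thesis by blast
      qed
    qed
  qed
  then show ?thesis using s' by (cases rule: rtranclE) auto
qed

lemma over_start_neq_under_start [simp]: "over_start l \<noteq> under_start l"
  by (cases l) auto

lemma next_level_inj:
  assumes "t < length w" "u < length w" "next_level w t = next_level w u"
  shows "t = u"
  using assms unfolding next_level_def
  by (metis Suc_inject Suc_lessI mod_less mod_self nat.distinct(1))

lemma joined_iff:
  "((i, t), (j, u)) \<in> joined m w \<longleftrightarrow> t < length w \<and> u = next_level w t \<and>
     (i = j \<and> i \<in> {1..m} \<and> i \<noteq> over_start (w ! t) \<and> i \<noteq> under_start (w ! t) \<or>
      i = over_start (w ! t) \<and> j = over_end (w ! t))"
  unfolding joined_def Un_iff mem_Collect_eq prod.inject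
  by (rule iffI; elim disjE exE conjE; simp)

text \<open>
  A crossing permutes the positions and the next level is an injective function of the
  level, so every segment continues at most one other segment.
\<close>
lemma joined_source_unique:
  assumes "(x, z) \<in> joined m w" "(y, z) \<in> joined m w"
  shows "x = y"
proof -
  obtain i t where x: "x = (i, t)" by (cases x)
  obtain i' t' where y: "y = (i', t')" by (cases y)
  obtain j u where z: "z = (j, u)" by (cases z)
  have "t = t'"
    by (rule next_level_inj[of _ w]) (use assms in \<open>auto simp: x y z joined_iff\<close>)
  with assms show ?thesis
    unfolding x y z joined_iff by (elim conjE disjE) simp_all
qed

text \<open>
  At its crossing, the position \<open>under_end\<close> on the next level is reached by the under strand
  only, and the under strand is the one that is not joined through the crossing.
\<close>
lemma under_end_not_in_Range_joined:
  assumes "t < length w"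
  shows "(under_end (w ! t), next_level w t) \<notin> Range (joined m w)"
proof
  assume "(under_end (w ! t), next_level w t) \<in> Range (joined m w)"
  then obtain s where s: "(s, (under_end (w ! t), next_level w t)) \<in> joined m w"
    by (rule RangeE)
  obtain i u where i: "s = (i, u)" by (cases s)
  have "u = t"
    by (rule next_level_inj[of _ w]) (use assms s in \<open>auto simp: i joined_iff\<close>)
  with s show False
    unfolding i joined_iff by (elim conjE disjE) simp_all
qed

text \<open>
  No arc starts at two undercrossings.  This makes the columns of the coloring matrix
  belong to different arcs, whatever the braid word is.
\<close>
lemma inj_on_under_arc_out: "inj_on (under_arc_out m w) {..<length w}"
proof (rule inj_onI)
  fix t u
  assume t: "t \<in> {..<length w}" and u: "u \<in> {..<length w}"
    and eq: "under_arc_out m w t = under_arc_out m w u"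
  let ?R = "joined m w"
  have "(under_end (w ! u), next_level w u) \<in> arc_of m w (under_end (w ! t), next_level w t)"
    using eq by (simp add: under_arc_out_def) (simp add: arc_of_def)
  then have "((under_end (w ! t), next_level w t), (under_end (w ! u), next_level w u)) \<in> (?R \<union> ?R\<inverse>)\<^sup>*"
    by (simp add: arc_of_def)
  then have "(under_end (w ! t), next_level w t) = (under_end (w ! u), next_level w u)"
  proof (rule component_source_unique[rotated])
    show "(under_end (w ! t), next_level w t) \<notin> Range ?R"
      using t by (intro under_end_not_in_Range_joined) simp
    show "(under_end (w ! u), next_level w u) \<notin> Range ?R"
      using u by (intro under_end_not_in_Range_joined) simp
  qed (rule joined_source_unique)
  then have "next_level w t = next_level w u" by simp
  with t u show "t = u" by (intro next_level_inj[of t w u]) simp_all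
qed

section \<open>Colorings and the determinant\<close>

lemma smult_one_mat_mult_vec:
  fixes v :: "'a :: comm_ring_1 vec"
  assumes "v \<in> carrier_vec n"
  shows "(k \<cdot>\<^sub>m 1\<^sub>m n) *\<^sub>v v = k \<cdot>\<^sub>v v"
proof (intro eq_vecI)
  fix i
  assume "i < dim_vec (k \<cdot>\<^sub>v v)"
  then have i: "i < n" using assms by simp
  then have "((k \<cdot>\<^sub>m 1\<^sub>m n) *\<^sub>v v) $ i = (k \<cdot>\<^sub>v unit_vec n i) \<bullet> v"
    by simp
  also have "\<dots> = k * v $ i"
    using assms i by (subst smult_scalar_prod_distrib[of _ n]) (auto simp: scalar_prod_left_unit)
  finally show "((k \<cdot>\<^sub>m 1\<^sub>m n) *\<^sub>v v) $ i = (k \<cdot>\<^sub>v v) $ i"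
    using assms i by simp
qed (use assms in simp)

text \<open>
  Multiplying \<open>A v\<close> by the adjugate of \<open>A\<close> gives \<open>det A\<close> times \<open>v\<close>.
\<close>
lemma dvd_det_mult_if_dvd_mult_mat_vec:
  fixes A :: "'a :: comm_ring_1 mat"
  assumes A: "A \<in> carrier_mat n n" and v: "v \<in> carrier_vec n" and j: "j < n"
    and dvd: "\<And>i. i < n \<Longrightarrow> q dvd (A *\<^sub>v v) $ i"
  shows "q dvd det A * v $ j"
proof -
  have adj: "adj_mat A \<in> carrier_mat n n" and eq: "adj_mat A * A = det A \<cdot>\<^sub>m 1\<^sub>m n"
    using adj_mat[OF A] by auto
  have "adj_mat A *\<^sub>v (A *\<^sub>v v) = (det A \<cdot>\<^sub>m 1\<^sub>m n) *\<^sub>v v"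
    using assoc_mult_mat_vec[OF adj A v] eq by simp
  also have "\<dots> = det A \<cdot>\<^sub>v v"
    using v by (rule smult_one_mat_mult_vec)
  finally have "det A * v $ j = (adj_mat A *\<^sub>v (A *\<^sub>v v)) $ j"
    using v j by simp
  also have "\<dots> = (\<Sum>i\<in>{0..<n}. adj_mat A $$ (j, i) * (A *\<^sub>v v) $ i)"
    using adj A v j by (auto simp: scalar_prod_def intro!: sum.cong)
  also have "q dvd \<dots>"
    using dvd by (intro dvd_sum dvd_mult) auto
  finally show ?thesis .
qed

definition valid_word :: "nat \<Rightarrow> braid_word \<Rightarrow> bool" where
  "valid_word m w \<longleftrightarrow> (\<forall>(i, s) \<in> set w. 1 \<le> i \<and> i < m)"

lemma crossing_arcs_in_arcs:
  assumes "valid_word m w" "t < length w"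
  shows "over_arc m w t \<in> arcs m w" "under_arc_in m w t \<in> arcs m w"
    "under_arc_out m w t \<in> arcs m w"
proof -
  obtain i s where l: "w ! t = (i, s)" by fastforce
  then have "1 \<le> i" "i < m"
    using assms nth_mem[OF assms(2)] by (auto simp: valid_word_def)
  moreover have "next_level w t < length w"
    using assms(2) unfolding next_level_def by (metis less_nat_zero_code mod_less_divisor neq0_conv)
  ultimately have seg: "(over_start (w ! t), t) \<in> segments m w"
    "(under_start (w ! t), t) \<in> segments m w" "(under_end (w ! t), next_level w t) \<in> segments m w"
    using l assms(2) by (auto simp: segments_def)
  show "over_arc m w t \<in> arcs m w" "under_arc_in m w t \<in> arcs m w"
    "under_arc_out m w t \<in> arcs m w"
    unfolding over_arc_def under_arc_in_def under_arc_out_def arcs_def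
    by (rule imageI, rule seg)+
qed

text \<open>
  A coloring modulo \<open>q\<close> forces divisors on the determinant without any evaluation of it.
  Shifted so that the arc of the deleted column gets color 0, the coloring is a vector that
  the minor of the coloring matrix kills modulo \<open>q\<close>; hence the determinant kills each of
  its entries modulo \<open>q\<close>.
\<close>
lemma dvd_determinant_mult_color_diff:
  fixes col :: "(nat \<times> nat) set \<Rightarrow> int"
  assumes valid: "valid_word m w"
    and starts: "arcs m w \<subseteq> under_arc_out m w ` {..<length w}"
    and col: "\<And>t. t < length w \<Longrightarrow>
      q dvd 2 * col (over_arc m w t) - col (under_arc_in m w t) - col (under_arc_out m w t)"
    and a: "a \<in> arcs m w" and b: "b \<in> arcs m w"
  shows "q dvd int (diagram_determinant m w) * (col a - col b)"
proof -
  define out where "out = under_arc_out m w"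
  define h where "h x = col x - col (out 0)" for x
  define A where "A = mat_delete (coloring_matrix m w) 0 0"
  obtain n where len: "length w = Suc n"
    using a starts by (cases "length w") auto
  have A: "A \<in> carrier_mat n n"
    by (simp add: A_def mat_delete_def coloring_matrix_def len)
  define v where "v = vec n (\<lambda>u. h (out (Suc u)))"
  have v: "v \<in> carrier_vec n" by (simp add: v_def)
  \<comment> \<open>Every arc belongs to exactly one column, so a row of the matrix evaluates the
    coloring relation.\<close>
  have pick: "(\<Sum>u<Suc n. of_bool (x = out u) * h (out u)) = h x" if "x \<in> arcs m w" for x
  proof -
    obtain u where u: "u < Suc n" "x = out u"
      using \<open>x \<in> arcs m w\<close> starts len by (auto simp: out_def)
    have "(x = out u') \<longleftrightarrow> u' = u" if "u' < Suc n" for u'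
      using inj_on_under_arc_out[of m w] that u len by (auto simp: out_def inj_on_def)
    then have "(\<Sum>u'<Suc n. of_bool (x = out u') * h (out u')) = (\<Sum>u'<Suc n. if u' = u then h x else 0)"
      using u by (intro sum.cong) auto
    with u show ?thesis by simp
  qed
  have Av: "q dvd (A *\<^sub>v v) $ t" if t: "t < n" for t
  proof -
    let ?c = "\<lambda>u. 2 * of_bool (over_arc m w (Suc t) = out u)
      - of_bool (under_arc_in m w (Suc t) = out u) - of_bool (under_arc_out m w (Suc t) = out u) :: int"
    \<comment> \<open>The deleted column can be put back, since \<open>h\<close> vanishes on its arc.\<close>
    have "(A *\<^sub>v v) $ t = (\<Sum>u<n. ?c (Suc u) * h (out (Suc u)))"
      using t by (auto simp: A_def v_def mat_delete_def coloring_matrix_def scalar_prod_def len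
          out_def atLeast0LessThan intro!: sum.cong)
    also have "\<dots> = (\<Sum>u<Suc n. ?c u * h (out u))"
      by (simp only: sum.lessThan_Suc_shift) (simp add: h_def)
    also have "\<dots> = 2 * (\<Sum>u<Suc n. of_bool (over_arc m w (Suc t) = out u) * h (out u))
        - (\<Sum>u<Suc n. of_bool (under_arc_in m w (Suc t) = out u) * h (out u))
        - (\<Sum>u<Suc n. of_bool (under_arc_out m w (Suc t) = out u) * h (out u))"
      by (simp only: left_diff_distrib sum_subtractf sum_distrib_left mult.assoc)
    also have "\<dots> = 2 * h (over_arc m w (Suc t)) - h (under_arc_in m w (Suc t))
        - h (under_arc_out m w (Suc t))"
      using crossing_arcs_in_arcs[OF valid, of "Suc t"] t len by (simp only: pick Suc_less_eq)
    also have "\<dots> = 2 * col (over_arc m w (Suc t)) - col (under_arc_in m w (Suc t))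
        - col (under_arc_out m w (Suc t))"
      by (simp add: h_def)
    finally show ?thesis
      using col[of "Suc t"] t len by (simp only: Suc_less_eq)
  qed
  have base: "q dvd det A * h x" if "x \<in> arcs m w" for x
  proof -
    obtain u where u: "u < Suc n" "x = out u"
      using \<open>x \<in> arcs m w\<close> starts len by (auto simp: out_def)
    show ?thesis
    proof (cases u)
      case 0
      then show ?thesis using u by (simp add: h_def)
    next
      case (Suc u')
      then show ?thesis
        using dvd_det_mult_if_dvd_mult_mat_vec[OF A v _ Av, of u'] u by (simp add: v_def)
    qed
  qed
  have "q dvd det A * (col a - col b)"
    using dvd_diff[OF base[OF a] base[OF b]] by (simp add: h_def algebra_simps)
  then show ?thesis
    by (cases "det A \<ge> 0") (auto simp: diagram_determinant_def A_def[symmetric])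
qed

section \<open>The Pell coloring\<close>

text \<open>
  The sequence 1, 1, 3, 7, 17, 41, ...; consecutive terms add up to twice a Pell number.
\<close>
fun half_companion_pell :: "nat \<Rightarrow> int" where
  "half_companion_pell 0 = 1"
| "half_companion_pell (Suc 0) = 1"
| "half_companion_pell (Suc (Suc n)) = 2 * half_companion_pell (Suc n) + half_companion_pell n"

lemma half_companion_pell_pos: "half_companion_pell n > 0"
  by (induction n rule: half_companion_pell.induct) auto

lemma odd_half_companion_pell: "odd (half_companion_pell n)"
  by (induction n rule: half_companion_pell.induct) auto

lemma half_companion_pell_less:
  assumes "1 \<le> i" "i < j"
  shows "half_companion_pell i < half_companion_pell j"
proof -
  have "half_companion_pell i < half_companion_pell (Suc i)" if "1 \<le> i" for i
    using that half_companion_pell_pos[of "i - 1"] half_companion_pell_pos[of i]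
    by (cases i) auto
  with assms(2,1) show ?thesis
    by (induction rule: strict_inc_induct) (auto intro: less_trans)
qed

lemma half_companion_pell_le:
  assumes "1 \<le> i" "i \<le> j"
  shows "half_companion_pell i \<le> half_companion_pell j"
  using assms half_companion_pell_less[of i j] by (cases "i = j") auto

text \<open>
  The integer coloring of the Turk's head diagram: the colors of the two rows (\<open>e\<close> even or
  odd) of the ladder of arcs defined below are opposite to each other.
\<close>
definition pell_color :: "nat \<Rightarrow> nat \<Rightarrow> int" where
  "pell_color e n = (-1) ^ e * half_companion_pell n"

text \<open>
  The recurrence of the half-companion Pell numbers is the coloring relation at the
  crossings of the ladder; the change of row supplies the minus sign.
\<close>
lemma pell_color_crossing:
  "1 \<le> n \<Longrightarrow> 2 * pell_color e n = pell_color e (Suc n) + pell_color (Suc e) (n - 1)"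
  by (cases n) (auto simp: pell_color_def algebra_simps)

lemma odd_pell_color: "odd (pell_color e n)"
  by (simp add: pell_color_def odd_half_companion_pell)

lemma abs_pell_color: "\<bar>pell_color e n\<bar> = half_companion_pell n"
  using half_companion_pell_pos[of n] by (simp add: pell_color_def abs_mult)

lemma pell_color_inj:
  assumes "pell_color e n = pell_color e' n'" "1 \<le> n" "1 \<le> n'"
  shows "n = n'" "even e \<longleftrightarrow> even e'"
proof -
  have "half_companion_pell n = half_companion_pell n'"
    using assms(1) abs_pell_color by metis
  then show n: "n = n'"
    using half_companion_pell_less[of n n'] half_companion_pell_less[of n' n] assms(2,3)
    by (metis less_irrefl linorder_neqE_nat)
  show "even e \<longleftrightarrow> even e'"
    using assms(1) half_companion_pell_pos[of n'] unfolding n pell_color_def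
    by (cases "even e"; cases "even e'") auto
qed

text \<open>
  The crossing relation expresses level \<open>n + 1\<close> of the ladder by the levels \<open>n\<close> and
  \<open>n - 1\<close>, so a coloring is determined by the two colors on level 0.  The two-parameter
  family of affine images of the Pell coloring realizes all choices of them.  The factor 2
  avoids halving: the Pell colors on level 0 are 1 and -1, not 0 and 1.
\<close>
lemma colors_affine_in_pell_color:
  fixes f :: "nat \<Rightarrow> nat \<Rightarrow> int"
  assumes ends: "\<And>e. f e 0 = f e 1" and period: "\<And>e n. f (e + 2) n = f e n"
    and crossing: "\<And>e n. 1 \<le> n \<Longrightarrow> n < m \<Longrightarrow> q dvd 2 * f e n - f e (Suc n) - f (Suc e) (n - 1)"
    and "n \<le> m"
  shows "q dvd 2 * f e n - (f 0 0 + f 1 0) - pell_color e n * (f 0 0 - f 1 0)"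
proof -
  \<comment> \<open>The deviation from the affine image satisfies the same relation and starts with zeros.\<close>
  define D where "D e n = 2 * f e n - (f 0 0 + f 1 0) - pell_color e n * (f 0 0 - f 1 0)" for e n
  have f0: "f e 0 = (if even e then f 0 0 else f 1 0)" for e
  proof (induction e rule: nat_less_induct)
    case (1 e)
    consider "e = 0" | "e = 1" | e' where "e = e' + 2"
      by (metis One_nat_def add_2_eq_Suc' not0_implies_Suc)
    then show ?case
      by cases (use 1 period in auto)
  qed
  have D0: "D e 0 = 0" for e
    using f0[of e] by (auto simp: D_def pell_color_def algebra_simps)
  have D1: "D e 1 = 0" for e
    using D0[of e] ends[of e] by (simp add: D_def pell_color_def)
  have "\<forall>e. n \<le> m \<longrightarrow> q dvd D e n" for n
  proof (induction n rule: half_companion_pell.induct)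
    case (3 n)
    show ?case
    proof (intro allI impI)
      fix e
      assume n: "Suc (Suc n) \<le> m"
      have "D e (Suc (Suc n)) = 2 * D e (Suc n) - D (Suc e) n
          - 2 * (2 * f e (Suc n) - f e (Suc (Suc n)) - f (Suc e) n)"
        using pell_color_crossing[of "Suc n" e]
        by (simp add: D_def algebra_simps pell_color_def)
      moreover have "q dvd 2 * D e (Suc n) - D (Suc e) n
          - 2 * (2 * f e (Suc n) - f e (Suc (Suc n)) - f (Suc e) n)"
        using 3 crossing[of "Suc n" e] n
        by (intro dvd_diff[OF dvd_diff[OF dvd_mult] dvd_mult]) auto
      ultimately show "q dvd D e (Suc (Suc n))" by simp
    qed
  qed (use D0 D1 in auto)
  with \<open>n \<le> m\<close> show ?thesis by (simp add: D_def)
qed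

section \<open>The closed braid with two blocks\<close>

abbreviation (input) thk :: "nat \<Rightarrow> braid_word" where
  "thk m \<equiv> turks_head_word m 2"

lemma length_turks_head_word_2: "length (thk m) = 2 * (m - 1)"
  by (simp add: turks_head_word_def numeral_2_eq_2)

lemma nth_turks_head_word_2:
  assumes "t < 2 * (m - 1)"
  shows "thk m ! t = (t mod (m - 1) + 1, even (t mod (m - 1)))"
proof -
  let ?b = "map (\<lambda>i. (i, odd i)) [1..<m]"
  have w: "thk m = ?b @ ?b"
    by (simp add: turks_head_word_def numeral_2_eq_2)
  show ?thesis
  proof (cases "t < m - 1")
    case True
    then show ?thesis by (simp add: w nth_append)
  next
    case False
    then obtain i where i: "t = (m - 1) + i" by (metis le_add_diff_inverse linorder_not_less)
    then have "i < m - 1" using assms by simp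
    moreover have "thk m ! t = ?b ! i"
      using i by (simp add: w nth_append)
    moreover have "t mod (m - 1) = i"
      using i \<open>i < m - 1\<close> by (metis mod_add_self1 mod_less)
    ultimately show ?thesis by simp
  qed
qed

lemma valid_turks_head_word: "valid_word m (thk m)"
  by (auto simp: valid_word_def turks_head_word_def)

text \<open>
  Reducing the level modulo the number of crossings lets blocks be counted by arbitrary
  natural numbers, of which only the parity matters.
\<close>
definition arc_at :: "nat \<Rightarrow> nat \<Rightarrow> nat \<Rightarrow> (nat \<times> nat) set" where
  "arc_at m j t = arc_of m (thk m) (j, t mod (2 * (m - 1)))"

text \<open>
  Within a block, the strand that starts in position 1 meets all other strands on its way to
  position \<open>m\<close>, alternately passing over and under them; each other strand moves one
  position to the left when it meets this traveling strand.  For \<open>1 \<le> n < m\<close>, the arc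
  \<open>ladder_arc m e n\<close> is the over arc at crossing \<open>n\<close> of block \<open>e + n div 2\<close>: the traveling
  strand if \<open>n\<close> is odd, the strand that starts the block in position \<open>n + 1\<close> if \<open>n\<close> is even.

  Advancing the block with \<open>n\<close> gives all crossings the same form: the over arc \<open>(e, n)\<close>
  separates the under arcs \<open>(e, n + 1)\<close> and \<open>(e + 1, n - 1)\<close>.  The arcs thus form a ladder
  of two rows, \<open>e\<close> even or odd; at both ends, \<open>n = 0\<close> and \<open>n = m\<close>, it is continued by
  arcs already present.
\<close>
definition ladder_arc :: "nat \<Rightarrow> nat \<Rightarrow> nat \<Rightarrow> (nat \<times> nat) set" where
  "ladder_arc m e n = (let b = e + n div 2 in
     if odd n then arc_at m n (b * (m - 1) + (n - 1)) else arc_at m (n + 1) (b * (m - 1)))"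

section \<open>Arcs and crossings of the Turk's head diagram\<close>

context
  fixes m :: nat
  assumes m: "m \<ge> 3" "odd m"
begin

lemma level_less: "t mod (2 * (m - 1)) < 2 * (m - 1)"
  using m by simp

lemma level_mod: "t mod (2 * (m - 1)) mod (m - 1) = t mod (m - 1)"
  by (simp add: mod_mod_cancel)

lemma nth_level: "thk m ! (t mod (2 * (m - 1))) = (t mod (m - 1) + 1, even (t mod (m - 1)))"
  using nth_turks_head_word_2[OF level_less[of t]] level_mod[of t] by simp

lemma next_level_eq: "next_level (thk m) (t mod (2 * (m - 1))) = Suc t mod (2 * (m - 1))"
  by (simp add: next_level_def length_turks_head_word_2 mod_Suc_eq)

lemma arc_at_stay:
  assumes "1 \<le> j" "j \<le> m" "j \<noteq> t mod (m - 1) + 1" "j \<noteq> t mod (m - 1) + 2"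
  shows "arc_at m j (Suc t) = arc_at m j t"
proof -
  let ?t = "t mod (2 * (m - 1))"
  have "((j, ?t), (j, next_level (thk m) ?t)) \<in> joined m (thk m)"
    using assms level_less[of t] unfolding joined_iff nth_level length_turks_head_word_2 by auto
  from arc_of_eq_if_joined[OF this] show ?thesis
    unfolding arc_at_def next_level_eq by simp
qed

lemma over_strand_at: "arc_at m (under_start (thk m ! (t mod (2 * (m - 1))))) (Suc t)
    = arc_at m (over_start (thk m ! (t mod (2 * (m - 1))))) t"
proof -
  let ?t = "t mod (2 * (m - 1))"
  have "((over_start (thk m ! ?t), ?t), (over_end (thk m ! ?t), next_level (thk m) ?t)) \<in> joined m (thk m)"
    using level_less[of t] unfolding joined_iff length_turks_head_word_2 by simp
  from arc_of_eq_if_joined[OF this] show ?thesis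
    unfolding arc_at_def next_level_eq by simp
qed

lemma level_in_block: "r < m - 1 \<Longrightarrow> (b * (m - 1) + r) mod (m - 1) = r"
  by simp

lemma arc_at_over_even:
  assumes "r < m - 1" "even r"
  shows "arc_at m (r + 2) (b * (m - 1) + r + 1) = arc_at m (r + 1) (b * (m - 1) + r)"
  using over_strand_at[of "b * (m - 1) + r"] assms(2)
  unfolding nth_level level_in_block[OF assms(1)] by simp

lemma arc_at_over_odd:
  assumes "r < m - 1" "odd r"
  shows "arc_at m (r + 1) (b * (m - 1) + r + 1) = arc_at m (r + 2) (b * (m - 1) + r)"
  using over_strand_at[of "b * (m - 1) + r"] assms(2)
  unfolding nth_level level_in_block[OF assms(1)] by simp

text \<open>
  Apart from the traveling strand, a strand keeps its position from the start of the block
  up to its crossing, and then from its crossing up to the start of the next block.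
\<close>
lemma arc_at_before_crossing:
  "r < m - 1 \<Longrightarrow> r + 2 \<le> j \<Longrightarrow> j \<le> m \<Longrightarrow> arc_at m j (b * (m - 1) + r) = arc_at m j (b * (m - 1))"
proof (induction r)
  case (Suc r)
  then show ?case
    using arc_at_stay[of j "b * (m - 1) + r"] level_in_block[of r b] by simp
qed simp

lemma arc_at_after_crossing:
  assumes "r \<le> m - 1" "1 \<le> j" "j \<le> r"
  shows "arc_at m j (b * (m - 1) + r) = arc_at m j (Suc b * (m - 1))"
  using assms
proof (induction r rule: inc_induct)
  case base
  show ?case by (simp add: add.commute)
next
  case (step r)
  then show ?case
    using arc_at_stay[of j "b * (m - 1) + r"] level_in_block[of r b] by simp
qed

lemma arc_at_block_cong:
  assumes "even b \<longleftrightarrow> even b'"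
  shows "arc_at m j (b * (m - 1) + r) = arc_at m j (b' * (m - 1) + r)"
proof -
  have "b mod 2 = b' mod 2" using assms by presburger
  then have "b * (m - 1) mod (2 * (m - 1)) = b' * (m - 1) mod (2 * (m - 1))"
    by (simp only: mult_mod_left[symmetric])
  then show ?thesis
    unfolding arc_at_def by (metis mod_add_left_eq)
qed

lemma arc_at_block_shift: "arc_at m j ((b + i + i) * (m - 1) + r) = arc_at m j (b * (m - 1) + r)"
  by (rule arc_at_block_cong) auto

lemma ladder_arc_cong:
  assumes "even e \<longleftrightarrow> even e'"
  shows "ladder_arc m e n = ladder_arc m e' n"
  using arc_at_block_cong[of "e + n div 2" "e' + n div 2"] 
    arc_at_block_cong[of "e + n div 2" "e' + n div 2" _ 0] assms
  by (simp add: ladder_arc_def Let_def)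

lemma ladder_arc_0: "ladder_arc m e 0 = ladder_arc m e 1"
  by (simp add: ladder_arc_def)

text \<open>
  The traveling strand ends in position \<open>m\<close>, where it starts the next block.
\<close>
lemma ladder_arc_m: "ladder_arc m e m = ladder_arc m (Suc e) (m - 1)"
proof -
  obtain k where "m = 2 * k + 1" using m by (auto elim: oddE)
  then show ?thesis by (simp add: ladder_arc_def algebra_simps)
qed

lemma arc_at_block_start_odd:
  assumes "odd j"
  shows "arc_at m j (b * (m - 1)) = ladder_arc m (b + (j - 1) div 2) (j - 1)"
  using assms arc_at_block_shift[of j b "(j - 1) div 2" 0]
  by (simp add: ladder_arc_def)

text \<open>
  A strand in an even position came there in the previous block from the odd position to its
  right, passing over the traveling strand; so its arc reaches back to the start of that block.
\<close>
lemma arc_at_block_start_even: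
  assumes "even j" "1 \<le> j" "j \<le> m"
  shows "arc_at m j (b * (m - 1)) = ladder_arc m (Suc b + j div 2) j"
proof -
  have j: "2 \<le> j" "j < m" using assms m by (auto simp: le_less intro: ccontr)
  \<comment> \<open>Block \<open>b + 1\<close> is the block before \<open>b\<close>, as there are two blocks.\<close>
  have "arc_at m j (b * (m - 1)) = arc_at m j (Suc (Suc b) * (m - 1))"
    using arc_at_block_cong[of b "Suc (Suc b)" j 0] by simp
  also have "\<dots> = arc_at m j (Suc b * (m - 1) + (j - 1) + 1)"
  proof -
    have "Suc b * (m - 1) + (j - 1) + 1 = Suc b * (m - 1) + j" using j by simp
    then show ?thesis using arc_at_after_crossing[of j j "Suc b"] j by simp
  qed
  also have "\<dots> = arc_at m (j + 1) (Suc b * (m - 1) + (j - 1))"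
    using arc_at_over_odd[of "j - 1" "Suc b"] j assms by simp
  also have "\<dots> = arc_at m (j + 1) (Suc b * (m - 1))"
    using arc_at_before_crossing[of "j - 1" "j + 1" "Suc b"] j by simp
  also have "\<dots> = ladder_arc m (Suc b + j div 2) j"
    using arc_at_block_start_odd[of "j + 1" "Suc b"] assms by simp
  finally show ?thesis .
qed

text \<open>
  At odd offsets the traveling strand is about to pass under and still belongs to the arc
  with which it passed over the preceding crossing.
\<close>
lemma arc_at_traveling:
  assumes "r < m - 1"
  shows "arc_at m (r + 1) (b * (m - 1) + r) =
    (if even r then ladder_arc m (b + (r + 1) div 2) (r + 1) else ladder_arc m (b + r div 2) r)"
proof (cases "even r")
  case True
  then show ?thesis
    using arc_at_block_shift[of "r + 1" b "(r + 1) div 2" r]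
    by (simp add: ladder_arc_def)
next
  case False
  then obtain i where i: "r = Suc (2 * i)" by (auto elim: oddE)
  show ?thesis
    using arc_at_over_even[of "2 * i" b] assms False
      arc_at_block_shift[of r b "r div 2" "2 * i"]
    by (simp add: ladder_arc_def i)
qed

text \<open>
  The parity of \<open>n\<close> decides which of the two under arcs comes in.  For odd \<open>n\<close> the under
  strand arrives from level \<open>n + 1\<close> of the previous block and leaves for the next block; for
  even \<open>n\<close> it is the traveling strand, which climbs from level \<open>n - 1\<close> to level \<open>n + 1\<close>.
\<close>
lemma crossing_arcs:
  assumes n: "1 \<le> n" "n < m" and b: "even b \<longleftrightarrow> even (e + n div 2)"
    and t: "t = (b * (m - 1) + (n - 1)) mod (2 * (m - 1))"
  shows "over_arc m (thk m) t = ladder_arc m e n"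
    and "under_arc_in m (thk m) t = (if odd n then ladder_arc m e (Suc n) else ladder_arc m (Suc e) (n - 1))"
    and "under_arc_out m (thk m) t = (if odd n then ladder_arc m (Suc e) (n - 1) else ladder_arc m e (Suc n))"
proof -
  obtain r where r: "n = Suc r" using n by (cases n) auto
  define T where "T = b * (m - 1) + r"
  have tT: "t = T mod (2 * (m - 1))" by (simp add: t T_def r)
  have "T mod (m - 1) = r" using n level_in_block[of r b] by (simp add: T_def r)
  then have letter: "thk m ! t = (n, even r)"
    using nth_level[of T] by (simp add: tT r)
  have over: "over_arc m (thk m) t = arc_at m (over_start (thk m ! t)) T"
    by (simp add: over_arc_def arc_at_def tT)
  have uin: "under_arc_in m (thk m) t = arc_at m (under_start (thk m ! t)) T"
    by (simp add: under_arc_in_def arc_at_def tT)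
  have out: "under_arc_out m (thk m) t = arc_at m (under_end (thk m ! t)) (Suc T)"
    by (simp only: under_arc_out_def arc_at_def tT next_level_eq)
  have r': "r < m - 1" "r + 2 \<le> m" using n r by auto
  have before: "arc_at m (r + 2) T = arc_at m (r + 2) (b * (m - 1))"
    unfolding T_def using r' by (intro arc_at_before_crossing) auto
  have shifted: "ladder_arc m (b + n div 2) n = ladder_arc m e n"
    using b by (intro ladder_arc_cong) auto
  show "over_arc m (thk m) t = ladder_arc m e n"
  proof (cases "odd n")
    case True
    then show ?thesis
      using arc_at_traveling[OF r'(1), of b] shifted
      unfolding over letter by (simp add: r T_def)
  next
    case False
    then show ?thesis
      using before arc_at_block_start_odd[of "r + 2" b] shifted
      unfolding over letter by (simp add: r)
  qed
  show "under_arc_in m (thk m) t = (if odd n then ladder_arc m e (Suc n) else ladder_arc m (Suc e) (n - 1))"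
  proof (cases "odd n")
    case True
    have "ladder_arc m (Suc b + (r + 2) div 2) (Suc n) = ladder_arc m e (Suc n)"
      using b True r by (intro ladder_arc_cong) auto
    then show ?thesis
      using True before arc_at_block_start_even[of "r + 2" b] r'
      unfolding uin letter by (simp add: r)
  next
    case False
    have "ladder_arc m (b + r div 2) r = ladder_arc m (Suc e) r"
      using b False r by (intro ladder_arc_cong) auto
    then show ?thesis
      using False arc_at_traveling[OF r'(1), of b]
      unfolding uin letter by (simp add: r T_def)
  qed
  show "under_arc_out m (thk m) t = (if odd n then ladder_arc m (Suc e) (n - 1) else ladder_arc m e (Suc n))"
  proof (cases "odd n")
    case True
    have "arc_at m (r + 1) (Suc T) = arc_at m (r + 1) (Suc b * (m - 1))"
      using arc_at_after_crossing[of "r + 1" "r + 1" b] r' by (simp add: T_def)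
    moreover have "ladder_arc m (Suc b + r div 2) r = ladder_arc m (Suc e) r"
      using b True r by (intro ladder_arc_cong) auto
    ultimately show ?thesis
      using True arc_at_block_start_odd[of "r + 1" "Suc b"]
      unfolding out letter by (simp add: r)
  next
    case False
    then show ?thesis
      using arc_at_block_cong[of b "e + Suc n div 2" "Suc n" n] b
      unfolding out letter by (simp add: r T_def ladder_arc_def)
  qed
qed

text \<open>
  The coloring relation is symmetric in the two under arcs, so it no longer depends on the
  parity of \<open>n\<close>.
\<close>
lemma crossing_sum:
  fixes col :: "(nat \<times> nat) set \<Rightarrow> int"
  assumes n: "1 \<le> n" "n < m" and b: "even b \<longleftrightarrow> even (e + n div 2)"
    and t: "t = (b * (m - 1) + (n - 1)) mod (2 * (m - 1))"
  shows "2 * col (over_arc m (thk m) t) - col (under_arc_in m (thk m) t) - col (under_arc_out m (thk m) t)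
    = 2 * col (ladder_arc m e n) - col (ladder_arc m e (Suc n)) - col (ladder_arc m (Suc e) (n - 1))"
  by (simp add: crossing_arcs[OF assms])

text \<open>
  Crossings of odd level start the arcs on the even levels below them, crossings of even
  level those on the odd levels above them; the identifications at the two ends of the
  ladder supply levels 1 and \<open>m - 1\<close>.
\<close>
lemma ladder_arc_starts:
  assumes "1 \<le> n" "n < m"
  shows "ladder_arc m e n \<in> under_arc_out m (thk m) ` {..<2 * (m - 1)}"
proof -
  have up: "ladder_arc m e (Suc n) \<in> under_arc_out m (thk m) ` {..<2 * (m - 1)}"
    if "even n" "1 \<le> n" "n < m" for e n
    using crossing_arcs(3)[OF that(2,3) refl refl, of e] that(1) level_less
    by (intro image_eqI[OF _ lessThan_iff[THEN iffD2]]) auto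
  have down: "ladder_arc m (Suc e) (n - 1) \<in> under_arc_out m (thk m) ` {..<2 * (m - 1)}"
    if "odd n" "n < m" for e n
  proof -
    have "1 \<le> n" using that(1) by (cases n) auto
    then show ?thesis
      using crossing_arcs(3)[OF _ that(2) refl refl, of e] that(1) level_less
      by (intro image_eqI[OF _ lessThan_iff[THEN iffD2]]) auto
  qed
  have ee: "ladder_arc m (Suc (Suc e)) n = ladder_arc m e n" by (rule ladder_arc_cong) simp
  consider "n = 1" | "odd n" "n \<noteq> 1" | "even n" "n = m - 1" | "even n" "n < m - 1"
    using assms by linarith
  then show ?thesis
  proof cases
    case 1
    then show ?thesis using down[of 1 "Suc e"] ee ladder_arc_0[of e] ladder_arc_0[of "Suc (Suc e)"] m by simp
  next
    case 2
    then have "even (n - 1)" "1 \<le> n - 1" "n - 1 < m" using assms by auto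
    from up[OF this, of e] show ?thesis using assms by simp
  next
    case 3
    then show ?thesis using up[of n "Suc e"] ee ladder_arc_m[of "Suc e"] assms by simp
  next
    case 4
    then show ?thesis using down[of "Suc n" "Suc e"] ee by simp
  qed
qed

lemma arcs_turks_head: "arcs m (thk m) = (\<lambda>(e, n). ladder_arc m e n) ` ({0, 1} \<times> {1..<m})"
proof -
  have norm: "ladder_arc m e n \<in> (\<lambda>(e, n). ladder_arc m e n) ` ({0, 1} \<times> {1..<m})" if "n < m" for e n
  proof -
    have "ladder_arc m e n = ladder_arc m (e mod 2) (max 1 n)"
      using ladder_arc_cong[of e "e mod 2" n] ladder_arc_0[of e] ladder_arc_cong[of e "e mod 2" 1]
      by (cases "n = 0") auto
    moreover have "(e mod 2, max 1 n) \<in> {0, 1} \<times> {1..<m}" using that m by auto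
    ultimately show ?thesis by (intro image_eqI) auto
  qed
  have start: "arc_at m j (b * (m - 1)) \<in> (\<lambda>(e, n). ladder_arc m e n) ` ({0, 1} \<times> {1..<m})"
    if j: "1 \<le> j" "j \<le> m" for j b
  proof (cases "odd j")
    case True
    with j m show ?thesis unfolding arc_at_block_start_odd[OF True] by (intro norm) auto
  next
    case False
    with m have "j \<noteq> m" by auto
    with j False show ?thesis
      unfolding arc_at_block_start_even[OF not_not[THEN iffD1, OF False] j] by (intro norm) auto
  qed
  show ?thesis
  proof (intro equalityI subsetI)
    fix x
    assume "x \<in> arcs m (thk m)"
    then obtain j t where x: "x = arc_of m (thk m) (j, t)" and j: "1 \<le> j" "j \<le> m"
      and t: "t < 2 * (m - 1)"
      by (auto simp: arcs_def segments_def length_turks_head_word_2)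
    define b r where "b = t div (m - 1)" and "r = t mod (m - 1)"
    have r: "r < m - 1" using m by (simp add: r_def)
    have x: "x = arc_at m j (b * (m - 1) + r)"
      by (simp only: x arc_at_def b_def r_def div_mult_mod_eq mod_less[OF t])
    consider "j \<le> r" | "j = r + 1" | "r + 2 \<le> j" by linarith
    then show "x \<in> (\<lambda>(e, n). ladder_arc m e n) ` ({0, 1} \<times> {1..<m})"
    proof cases
      case 1
      then show ?thesis using arc_at_after_crossing[of r j b] r j start[OF j, of "Suc b"] by (simp add: x)
    next
      case 2
      from r have "r + 1 < m" "r < m" by linarith+
      then show ?thesis
        unfolding x 2 arc_at_traveling[OF r]
        by (cases "even r") (simp_all only: if_True if_False norm)
    next
      case 3
      then show ?thesis using arc_at_before_crossing[of r j b] r j start[OF j, of b] by (simp add: x)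
    qed
  next
    fix x
    assume "x \<in> (\<lambda>(e, n). ladder_arc m e n) ` ({0, 1} \<times> {1..<m})"
    then obtain t where "x = under_arc_out m (thk m) t" "t < 2 * (m - 1)"
      using ladder_arc_starts by fastforce
    then show "x \<in> arcs m (thk m)"
      using crossing_arcs_in_arcs(3)[OF valid_turks_head_word] by (simp add: length_turks_head_word_2)
  qed
qed

lemma arcs_are_starts: "arcs m (thk m) = under_arc_out m (thk m) ` {..<length (thk m)}"
  using arcs_turks_head ladder_arc_starts crossing_arcs_in_arcs(3)[OF valid_turks_head_word, of _ m]
  by (auto simp: length_turks_head_word_2)

text \<open>
  There are as many labels as crossings, hence as many as arcs, because different
  undercrossings start different arcs.
\<close>
lemma inj_on_ladder_arc: "inj_on (\<lambda>(e, n). ladder_arc m e n) ({0, 1} \<times> {1..<m})"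
proof (rule eq_card_imp_inj_on)
  have "card (arcs m (thk m)) = 2 * (m - 1)"
    unfolding arcs_are_starts card_image[OF inj_on_under_arc_out]
    by (simp add: length_turks_head_word_2)
  then show "card ((\<lambda>(e, n). ladder_arc m e n) ` ({0, 1} \<times> {1..<m})) = card ({0::nat, 1} \<times> {1..<m})"
    unfolding arcs_turks_head[symmetric] by (simp add: card_cartesian_product)
qed simp

section \<open>Colorings of a diagram of prime determinant\<close>

lemma ex_pell_coloring:
  obtains col where "\<And>e n. n < m \<Longrightarrow> col (ladder_arc m e n) = pell_color e n"
proof
  define col where "col x = (case inv_into ({0, 1} \<times> {1..<m}) (\<lambda>(e, n). ladder_arc m e n) x of
    (e, n) \<Rightarrow> pell_color e n)" for x
  fix e n
  assume n: "n < m"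
  have "ladder_arc m e n = ladder_arc m (e mod 2) (max 1 n)"
    using ladder_arc_cong[of e "e mod 2" n] ladder_arc_0[of e] ladder_arc_cong[of e "e mod 2" 1]
    by (cases "n = 0") auto
  moreover have "(e mod 2, max 1 n) \<in> {0, 1} \<times> {1..<m}" using n m by auto
  then have "col (ladder_arc m (e mod 2) (max 1 n)) = pell_color (e mod 2) (max 1 n)"
    using inv_into_f_f[OF inj_on_ladder_arc, of "(e mod 2, max 1 n)"] by (simp add: col_def)
  moreover have "pell_color (e mod 2) (max 1 n) = pell_color e n"
    by (cases "n = 0") (auto simp: pell_color_def max_def minus_one_power_iff)
  ultimately show "col (ladder_arc m e n) = pell_color e n" by simp
qed

text \<open>
  The Pell coloring satisfies the relation at all crossings exactly, except at the last
  crossing of each block: there it fails, up to sign, by the sum of two consecutive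
  half-companion Pell numbers, so it is a coloring modulo that sum.  The arcs of level 1 have colors 1 and -1,
  which leaves the factor 2.
\<close>
lemma dvd_twice_determinant:
  "half_companion_pell m + half_companion_pell (m - 1)
    dvd 2 * int (diagram_determinant m (thk m))"
proof -
  let ?q = "half_companion_pell m + half_companion_pell (m - 1)"
  obtain col where col: "\<And>e n. n < m \<Longrightarrow> col (ladder_arc m e n) = pell_color e n"
    using ex_pell_coloring by blast
  have "?q dvd int (diagram_determinant m (thk m)) * (col (ladder_arc m 0 1) - col (ladder_arc m 1 1))"
  proof (rule dvd_determinant_mult_color_diff[OF valid_turks_head_word])
    show "arcs m (thk m) \<subseteq> under_arc_out m (thk m) ` {..<length (thk m)}"
      by (simp add: arcs_are_starts)
    show "ladder_arc m 0 1 \<in> arcs m (thk m)" "ladder_arc m 1 1 \<in> arcs m (thk m)"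
      using m by (auto simp: arcs_turks_head)
    fix t
    assume "t < length (thk m)"
    then have t: "t < 2 * (m - 1)" by (simp only: length_turks_head_word_2)
    define b n where "b = t div (m - 1)" and "n = Suc (t mod (m - 1))"
    define e where "e = b + n div 2"
    have parity: "even b \<longleftrightarrow> even (e + n div 2)" by (auto simp: e_def)
    have "t mod (m - 1) < m - 1" using m by simp
    then have n: "1 \<le> n" "n < m" unfolding n_def by linarith+
    have "t = (b * (m - 1) + (n - 1)) mod (2 * (m - 1))"
      by (simp only: b_def n_def diff_Suc_1 div_mult_mod_eq mod_less[OF t])
    note sum = crossing_sum[OF n parity this, where col = col]
    have "?q dvd 2 * pell_color e n - col (ladder_arc m e (Suc n)) - pell_color (Suc e) (n - 1)"
    proof (cases "Suc n = m")
      case False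
      then show ?thesis using n pell_color_crossing[of n e] by (simp add: col)
    next
      case True
      then have nm: "n = m - 1" by simp
      have "2 * pell_color e n - col (ladder_arc m e (Suc n)) - pell_color (Suc e) (n - 1)
          = pell_color e (Suc n) - pell_color (Suc e) n"
        using pell_color_crossing[of n e] n True ladder_arc_m[of e] by (simp add: col nm)
      also have "\<dots> = (-1) ^ e * ?q"
        using True by (simp add: pell_color_def nm algebra_simps)
      finally show ?thesis by simp
    qed
    then show "?q dvd 2 * col (over_arc m (thk m) t) - col (under_arc_in m (thk m) t)
        - col (under_arc_out m (thk m) t)"
      using n by (simp add: sum col)
  qed
  then show ?thesis
    using m by (simp add: col pell_color_def mult.commute)
qed

text \<open>
  Half of the sum of consecutive half-companion Pell numbers is an integer greater than 1
  that divides the determinant, so it equals a prime determinant.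
\<close>
lemma prime_determinant:
  assumes "prime (diagram_determinant m (thk m))"
  shows "2 * int (diagram_determinant m (thk m)) = half_companion_pell m + half_companion_pell (m - 1)"
    and "odd (diagram_determinant m (thk m))"
proof -
  let ?p = "diagram_determinant m (thk m)"
  obtain q where q: "half_companion_pell m + half_companion_pell (m - 1) = 2 * q"
    using odd_half_companion_pell by (metis evenE odd_add)
  have "3 \<le> half_companion_pell (m - 1)" "3 < half_companion_pell m"
    using half_companion_pell_le[of 2 "m - 1"] half_companion_pell_less[of 2 m] m
    by (auto simp: numeral_2_eq_2)
  then have "q > 3" using q by simp
  have "q dvd int ?p" using dvd_twice_determinant q by simp
  then have "nat q dvd ?p" using \<open>q > 3\<close> by (simp add: nat_dvd_iff)
  with assms have "nat q = ?p" using \<open>q > 3\<close> by (auto simp: prime_nat_iff)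
  then have qp: "q = int ?p" using \<open>q > 3\<close> by simp
  then show "2 * int ?p = half_companion_pell m + half_companion_pell (m - 1)" using q by simp
  show "odd ?p" using assms \<open>q > 3\<close> qp by (intro prime_odd_nat) auto
qed

lemma fox_coloring_crossing:
  assumes "fox_coloring p m (thk m) c" "1 \<le> n" "n < m"
  shows "int p dvd 2 * c (ladder_arc m e n) - c (ladder_arc m e (Suc n)) - c (ladder_arc m (Suc e) (n - 1))"
proof -
  let ?t = "((e + n div 2) * (m - 1) + (n - 1)) mod (2 * (m - 1))"
  have "?t < length (thk m)"
    unfolding length_turks_head_word_2 by (rule level_less)
  then have "int p dvd 2 * c (over_arc m (thk m) ?t) - c (under_arc_in m (thk m) ?t)
      - c (under_arc_out m (thk m) ?t)"
    using assms(1) unfolding fox_coloring_def cong_0_iff by blast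
  then show ?thesis
    unfolding crossing_sum[OF assms(2,3) refl refl] .
qed

lemma fox_coloring_affine:
  assumes "fox_coloring p m (thk m) c" "n \<le> m"
  shows "int p dvd 2 * c (ladder_arc m e n) - (c (ladder_arc m 0 0) + c (ladder_arc m 1 0))
    - pell_color e n * (c (ladder_arc m 0 0) - c (ladder_arc m 1 0))"
  using ladder_arc_0 ladder_arc_cong[of "_ + 2" _] fox_coloring_crossing[OF assms(1)] assms(2)
  by (intro colors_affine_in_pell_color[where f = "\<lambda>e n. c (ladder_arc m e n)"]) auto

text \<open>
  The \<open>p\<close>-coloring is affine in the Pell coloring, with a slope \<open>d\<close> that is invertible
  because the coloring is non-trivial.  Two arcs of equal color therefore have Pell colors
  that agree modulo \<open>p\<close>, and modulo \<open>2 p\<close> as all Pell colors are odd.  But Pell colors on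
  the arcs are at most \<open>half_companion_pell (m - 1)\<close> in absolute value, which is less than
  \<open>p\<close>; hence they are equal, and distinct arcs have distinct Pell colors.
\<close>
lemma prime_coloring_inj:
  assumes det: "diagram_determinant m (thk m) = p" and p: "prime p"
    and fox: "fox_coloring p m (thk m) c" and nontrivial: "nontrivial_coloring m (thk m) c"
  shows "inj_on c (arcs m (thk m))"
proof (rule inj_onI)
  define a d where "a = c (ladder_arc m 0 0) + c (ladder_arc m 1 0)"
    and "d = c (ladder_arc m 0 0) - c (ladder_arc m 1 0)"
  have sum: "2 * int p = half_companion_pell m + half_companion_pell (m - 1)" and "odd p"
    using prime_determinant p det by auto
  have prime: "prime (int p)" using p by simp
  have coprime: "coprime (int p) 2" using \<open>odd p\<close> by simp
  have affine: "int p dvd 2 * c (ladder_arc m e n) - a - pell_color e n * d" if "n < m" for e n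
    using fox_coloring_affine[OF fox, of n e] that by (simp add: a_def d_def)
  have d: "\<not> int p dvd d"
  proof
    assume d: "int p dvd d"
    have *: "int p dvd 2 * c x - a" "c x \<in> {0..<int p}" if x: "x \<in> arcs m (thk m)" for x
    proof -
      obtain e n where "x = ladder_arc m e n" "n < m" using x by (auto simp: arcs_turks_head)
      then show "int p dvd 2 * c x - a"
        using affine[of n e] d by (metis diff_add_cancel dvd_add dvd_mult)
      show "c x \<in> {0..<int p}" using fox x by (simp add: fox_coloring_def)
    qed
    have "c x = c y" if xy: "x \<in> arcs m (thk m)" "y \<in> arcs m (thk m)" for x y
    proof -
      have "int p dvd 2 * (c x - c y)"
        using dvd_diff[OF *(1)[OF xy(1)] *(1)[OF xy(2)]] by (simp add: algebra_simps)
      then have "int p dvd c x - c y"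
        using coprime_dvd_mult_right_iff[OF coprime] by blast
      then show ?thesis
        using *(2)[OF xy(1)] *(2)[OF xy(2)] by (simp add: mod_eq_dvd_iff[symmetric])
    qed
    with nontrivial show False unfolding nontrivial_coloring_def by blast
  qed
  fix x y
  assume x: "x \<in> arcs m (thk m)" and y: "y \<in> arcs m (thk m)" and eq: "c x = c y"
  obtain e n where xe: "x = ladder_arc m e n" and n: "1 \<le> n" "n < m" using x by (auto simp: arcs_turks_head)
  obtain e' n' where ye: "y = ladder_arc m e' n'" and n': "1 \<le> n'" "n' < m" using y by (auto simp: arcs_turks_head)
  let ?D = "pell_color e n - pell_color e' n'"
  have "int p dvd ?D * d"
    using dvd_diff[OF affine[OF n'(2), of e'] affine[OF n(2), of e]] eq
    by (simp add: xe ye algebra_simps)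
  then have "int p dvd ?D" using d prime_dvd_mult_iff[OF prime] by blast
  moreover have "2 dvd ?D" using odd_pell_color by simp
  ultimately have "2 * int p dvd ?D"
    using coprime by (metis coprime_commute divides_mult)
  moreover have "\<bar>?D\<bar> < 2 * int p"
  proof -
    have "\<bar>?D\<bar> \<le> half_companion_pell n + half_companion_pell n'"
      using abs_triangle_ineq4[of "pell_color e n" "pell_color e' n'"] by (simp add: abs_pell_color)
    also have "\<dots> \<le> half_companion_pell (m - 1) + half_companion_pell (m - 1)"
      using n n' by (intro add_mono half_companion_pell_le) auto
    also have "\<dots> < 2 * int p"
      using half_companion_pell_less[of "m - 1" m] m by (simp add: sum)
    finally show ?thesis .
  qed
  ultimately have "?D = 0" by (metis abs_ge_zero abs_of_pos dvd_imp_le_int linorder_not_le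
        abs_dvd_iff prime_gt_0_int mult_pos_pos zero_less_numeral prime)
  then show "x = y"
    using pell_color_inj[of e n e' n'] n(1) n'(1) ladder_arc_cong[of e e' n] by (simp add: xe ye)
qed

end

theorem theorem3:
  fixes m p :: nat and c :: "(nat \<times> nat) set \<Rightarrow> int"
  assumes "m \<ge> 3" and "odd m"
    and "prime p"
    and "diagram_determinant m (turks_head_word m 2) = p"
    and "fox_coloring p m (turks_head_word m 2) c"
    and "nontrivial_coloring m (turks_head_word m 2) c"
  shows "inj_on c (arcs m (turks_head_word m 2))"
  using assms by (intro prime_coloring_inj)

end
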